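(* Testing whether an assignment in $\{0,1\}^{2^h}$ satisfies the monotone sub-balancing formula of height $h$, with farness parameter $\epsilon=1/12$, requires $\Omega(h)$ queries for any non-adaptive test and $\Omega(\log h)$ queries for any (possibly adaptive) test.
   Context: Alphabet $\Sigma=\{0,F_0,P,F_1,1\}$, ordered in this order. The monotone balancing gate takes two inputs from $\Sigma$ and outputs: $0$ on $(0,0)$; $1$ on $(1,1)$; $P$ on $(1,0)$, $(0,1)$, $(P,P)$; $F_0$ on $(0,P)$, $(P,0)$, $(P,F_0)$, $(F_0,P)$, $(F_0,0)$, $(0,F_0)$, $(F_0,F_0)$; $F_1$ on $(1,P)$, $(P,1)$, $(F_0,1)$, $(1,F_0)$, and on every pair containing $F_1$. The monotone sub-balancing formula of height $h$ is the full balanced binary tree of height $h$ with leaves $x_0,\dots,x_{2^h-1}$ and all internal gates monotone balancing gates; an assignment satisfies it iff the root value is neither $F_1$ nor $1$. An $\epsilon$-test with $q$ queries is a randomized algorithm querying at most $q$ values of the unknown assignment, accepting every satisfying assignment with probability at least $2/3$, and rejecting with probability at least $2/3$ every assignment whose Hamming distance from every satisfying assignment exceeds $\epsilon\cdot 2^h$. It is non-adaptive if its queries do not depend on previous answers. *)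

theory Defs
  imports "HOL-Probability.Probability"
begin

text \<open>The alphabet, with the constructors listed in increasing order.\<close>

datatype sym = S0 | SF0 | SP | SF1 | S1

fun balancing_gate :: "sym \<Rightarrow> sym \<Rightarrow> sym" where
  "balancing_gate SF1 _ = SF1"
| "balancing_gate _ SF1 = SF1"
| "balancing_gate S0 S0 = S0"
| "balancing_gate S1 S1 = S1"
| "balancing_gate S1 S0 = SP"
| "balancing_gate S0 S1 = SP"
| "balancing_gate SP SP = SP"
| "balancing_gate S0 SP = SF0"
| "balancing_gate SP S0 = SF0"
| "balancing_gate SP SF0 = SF0"
| "balancing_gate SF0 SP = SF0"
| "balancing_gate SF0 S0 = SF0"
| "balancing_gate S0 SF0 = SF0"
| "balancing_gate SF0 SF0 = SF0"
| "balancing_gate S1 SP = SF1"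
| "balancing_gate SP S1 = SF1"
| "balancing_gate SF0 S1 = SF1"
| "balancing_gate S1 SF0 = SF1"

datatype formula = Leaf nat | Gate formula formula

text \<open>\<open>full_formula h i\<close> is the full binary tree of height \<open>h\<close> whose leaves, from left to
  right, are the variables with indices \<open>i, \<dots>, i + 2 ^ h - 1\<close>.\<close>

fun full_formula :: "nat \<Rightarrow> nat \<Rightarrow> formula" where
  "full_formula 0 i = Leaf i"
| "full_formula (Suc h) i = Gate (full_formula h i) (full_formula h (i + 2 ^ h))"

definition sub_balancing_formula :: "nat \<Rightarrow> formula" where
  "sub_balancing_formula h = full_formula h 0"

fun formula_value :: "formula \<Rightarrow> bool list \<Rightarrow> sym" where
  "formula_value (Leaf i) x = (if x ! i then S1 else S0)"
| "formula_value (Gate f g) x = balancing_gate (formula_value f x) (formula_value g x)"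

definition assignments :: "nat \<Rightarrow> bool list set" where
  "assignments h = {x. length x = 2 ^ h}"

definition satisfies :: "nat \<Rightarrow> bool list \<Rightarrow> bool" where
  "satisfies h x \<longleftrightarrow> formula_value (sub_balancing_formula h) x \<notin> {SF1, S1}"

definition hamming_dist :: "bool list \<Rightarrow> bool list \<Rightarrow> nat" where
  "hamming_dist x y = card {i. i < length x \<and> x ! i \<noteq> y ! i}"

definition is_far :: "real \<Rightarrow> nat \<Rightarrow> bool list \<Rightarrow> bool" where
  "is_far \<epsilon> h x \<longleftrightarrow>
     (\<forall>y\<in>assignments h. satisfies h y \<longrightarrow> real (hamming_dist x y) > \<epsilon> * 2 ^ h)"

text \<open>Deterministic query algorithms. \<open>Query i t u\<close> reads position \<open>i\<close> and continues with
  \<open>t\<close> if the bit read is 1 and with \<open>u\<close> if it is 0; \<open>Answer True\<close> means acceptance.\<close>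

datatype decision_tree = Answer bool | Query nat decision_tree decision_tree

fun accepts :: "decision_tree \<Rightarrow> bool list \<Rightarrow> bool" where
  "accepts (Answer b) x = b"
| "accepts (Query i t u) x = accepts (if x ! i then t else u) x"

fun queries :: "decision_tree \<Rightarrow> bool list \<Rightarrow> nat list" where
  "queries (Answer b) x = []"
| "queries (Query i t u) x = i # queries (if x ! i then t else u) x"

text \<open>A randomized algorithm is a probability distribution on deterministic ones: all coins are
  tossed in advance. On inputs of a fixed length there are only finitely many deterministic
  algorithms with at most \<open>q\<close> queries, so discrete distributions suffice.\<close>

definition is_test :: "real \<Rightarrow> nat \<Rightarrow> nat \<Rightarrow> decision_tree pmf \<Rightarrow> bool" where
  "is_test \<epsilon> h q T \<longleftrightarrow>
     (\<forall>t\<in>set_pmf T. \<forall>x\<in>assignments h.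
        set (queries t x) \<subseteq> {..<2 ^ h} \<and> length (queries t x) \<le> q) \<and>
     (\<forall>x\<in>assignments h. satisfies h x \<longrightarrow> measure_pmf.prob T {t. accepts t x} \<ge> 2 / 3) \<and>
     (\<forall>x\<in>assignments h. is_far \<epsilon> h x \<longrightarrow> measure_pmf.prob T {t. \<not> accepts t x} \<ge> 2 / 3)"

text \<open>Non-adaptive: once the coins are fixed, the queries made are the same on all inputs.\<close>

definition nonadaptive :: "nat \<Rightarrow> decision_tree pmf \<Rightarrow> bool" where
  "nonadaptive h T \<longleftrightarrow>
     (\<forall>t\<in>set_pmf T. \<forall>x\<in>assignments h. \<forall>y\<in>assignments h. queries t x = queries t y)"

end

theory Submission
  imports Defs
begin

text \<open>Yao's principle, with about \<open>h / 3\<close> pairs of input distributions, one for each level \<open>i\<close>.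
  Cut the leaves into units of length \<open>8 ^ i\<close> and blocks of eight units. The satisfying inputs
  carry the pattern 01010101 on every block, the far ones 11100001, and in both cases every block
  is complemented independently with probability 1/2. A set of positions that meets no block in
  two different units sees uniform independent bits in both cases, and a set \<open>Q\<close> of positions
  violates this condition for at most \<open>|Q|\<close> of the levels. Averaging over the levels, a test
  whose deterministic algorithms can each query at most \<open>K\<close> positions overall needs
  \<open>3 * K \<ge> h div 3\<close>. Here \<open>K = q\<close> without adaptivity, and \<open>K = 2 ^ q\<close> for decision trees of
  depth \<open>q\<close>.\<close>

section \<open>Subtree values and the density of ones\<close>

lemma formula_value_S1_iff:
  "formula_value (full_formula n s) x = S1 \<longleftrightarrow> (\<forall>a\<in>{s..<s + 2 ^ n}. x ! a)"
proof (induction n arbitrary: s)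
  case (Suc n)
  have gate: "balancing_gate u v = S1 \<longleftrightarrow> u = S1 \<and> v = S1" for u v
    by (cases u; cases v) auto
  have "{s..<s + 2 ^ Suc n} = {s..<s + 2 ^ n} \<union> {s + 2 ^ n..<s + 2 ^ n + 2 ^ n}"
    by auto
  then show ?case
    by (simp only: full_formula.simps formula_value.simps gate Suc.IH ball_Un)
qed auto

lemma formula_value_S0_iff:
  "formula_value (full_formula n s) x = S0 \<longleftrightarrow> (\<forall>a\<in>{s..<s + 2 ^ n}. \<not> x ! a)"
proof (induction n arbitrary: s)
  case (Suc n)
  have gate: "balancing_gate u v = S0 \<longleftrightarrow> u = S0 \<and> v = S0" for u v
    by (cases u; cases v) auto
  have "{s..<s + 2 ^ Suc n} = {s..<s + 2 ^ n} \<union> {s + 2 ^ n..<s + 2 ^ n + 2 ^ n}"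
    by auto
  then show ?case
    by (simp only: full_formula.simps formula_value.simps gate Suc.IH ball_Un)
qed auto

lemma balancing_gate_eq_SF1:
  "balancing_gate u v = SF1 \<longleftrightarrow>
     u = SF1 \<or> v = SF1 \<or> u = S1 \<and> v \<in> {SP, SF0} \<or> v = S1 \<and> u \<in> {SP, SF0}"
  by (cases u; cases v) auto

text \<open>Induction on the height. A gate value outside \<open>{SF1, S1}\<close> leaves two cases:
  both inputs avoid these values, so each half is at most half ones, or one input is
  \<open>S0\<close>, so that half has no ones at all.\<close>

lemma card_ones_le_half:
  assumes "formula_value (full_formula n s) x \<notin> {SF1, S1}"
  shows "2 * card {a\<in>{s..<s + 2 ^ n}. x ! a} \<le> 2 ^ n"
  using assms
proof (induction n arbitrary: s)
  case 0
  then have "{a\<in>{s..<s + 2 ^ 0}. x ! a} = {}"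
    by (auto split: if_splits)
  then show ?case
    by (simp only: card.empty mult_0_right zero_le)
next
  case (Suc n)
  let ?O = "\<lambda>s. {a\<in>{s..<s + 2 ^ n}. x ! a}"
  let ?u = "formula_value (full_formula n s) x" and ?v = "formula_value (full_formula n (s + 2 ^ n)) x"
  have "{a\<in>{s..<s + 2 ^ Suc n}. x ! a} = ?O s \<union> ?O (s + 2 ^ n)"
    by auto
  then have split: "card {a\<in>{s..<s + 2 ^ Suc n}. x ! a} \<le> card (?O s) + card (?O (s + 2 ^ n))"
    by (simp only: card_Un_le)
  have le: "card (?O s) \<le> 2 ^ n" for s
  proof -
    have "card (?O s) \<le> card {s..<s + 2 ^ n}"
      by (intro card_mono) auto
    then show ?thesis
      by simp
  qed
  have empty: "card (?O s) = 0" if "formula_value (full_formula n s) x = S0" for s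
  proof -
    have "?O s = {}"
      using that unfolding formula_value_S0_iff by blast
    then show ?thesis
      by (simp only: card.empty)
  qed
  have gate: "u \<notin> {SF1, S1} \<and> v \<notin> {SF1, S1} \<or> u = S0 \<or> v = S0"
    if "balancing_gate u v \<notin> {SF1, S1}" for u v
    using that by (cases u; cases v) auto
  have "balancing_gate ?u ?v \<notin> {SF1, S1}"
    using Suc.prems by simp
  then consider "?u \<notin> {SF1, S1}" "?v \<notin> {SF1, S1}" | "?u = S0" | "?v = S0"
    using gate[of ?u ?v] by blast
  then have "card (?O s) + card (?O (s + 2 ^ n)) \<le> 2 ^ n"
  proof cases
    case 1
    then show ?thesis
      using Suc.IH[of s] Suc.IH[of "s + 2 ^ n"] by linarith
  next
    case 2
    then show ?thesis
      using empty[of s] le[of "s + 2 ^ n"] by linarith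
  next
    case 3
    then show ?thesis
      using empty[of "s + 2 ^ n"] le[of s] by linarith
  qed
  then show ?case
    using split by simp
qed

section \<open>Inputs built from complemented blocks\<close>

text \<open>Inputs that are constant on units of length \<open>8 ^ i\<close>: every block of eight consecutive
  units carries the pattern \<open>p\<close>, complemented on the blocks whose number lies in \<open>B\<close>.\<close>

definition block_bit :: "(nat \<Rightarrow> bool) \<Rightarrow> nat \<Rightarrow> nat set \<Rightarrow> nat \<Rightarrow> bool" where
  "block_bit p i B a \<longleftrightarrow> (a div 8 ^ Suc i \<in> B) \<noteq> p (a div 8 ^ i mod 8)"

definition block_input :: "(nat \<Rightarrow> bool) \<Rightarrow> nat \<Rightarrow> nat \<Rightarrow> nat set \<Rightarrow> bool list" where
  "block_input p h i B = map (block_bit p i B) [0..<2 ^ h]"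

text \<open>The halves 1110 and 0001 of this pattern are swapped by complementation, so every block
  has a half 1110 whether or not it is complemented.\<close>

definition far_pattern :: "nat \<Rightarrow> bool" where
  "far_pattern u \<longleftrightarrow> u \<in> {0, 1, 2, 7}"

lemma length_block_input [simp]: "length (block_input p h i B) = 2 ^ h"
  by (simp add: block_input_def)

lemma nth_block_input [simp]: "a < 2 ^ h \<Longrightarrow> block_input p h i B ! a = block_bit p i B a"
  by (simp add: block_input_def)

lemma block_bit_unit:
  assumes "a \<in> {8 ^ i * (8 * k + u)..<8 ^ i * (8 * k + u + 1)}" "u < 8"
  shows "block_bit p i B a \<longleftrightarrow> (k \<in> B) \<noteq> p u"
proof -
  have unit: "a div 8 ^ i = 8 * k + u"
    using assms(1) by (intro div_nat_eqI) (auto simp: algebra_simps)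
  moreover have "a div 8 ^ Suc i = a div 8 ^ i div 8"
    by (simp only: power_Suc2 div_mult2_eq)
  moreover have "(8 * k + u) div 8 = k"
    using assms(2) by simp
  moreover have "(8 * k + u) mod 8 = u"
    using assms(2) by simp
  ultimately show ?thesis
    by (simp only: block_bit_def)
qed

section \<open>Satisfying inputs\<close>

text \<open>Units \<open>2 * k\<close> and \<open>2 * k + 1\<close> lie in one block and are
  constant with opposite values, complemented or not, so the gate joining them gives
  \<open>SP\<close>; the \<open>d\<close> levels above preserve \<open>SP\<close>.\<close>

lemma formula_value_odd:
  assumes "\<forall>a\<in>{8 ^ i * (2 * k)..<8 ^ i * (2 * k) + 2 ^ (3 * i + 1 + d)}. x ! a = block_bit odd i B a"
  shows "formula_value (full_formula (3 * i + 1 + d) (8 ^ i * (2 * k))) x = SP"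
  using assms
proof (induction d arbitrary: k)
  case 0
  \<comment> \<open>A block holds four pairs of units: \<open>K\<close> is the block of the pair and
    \<open>u\<close> the offset of its first unit there.\<close>
  define K u where "K = k div 4" and "u = 2 * (k mod 4)"
  have k: "2 * k = 8 * K + u" "Suc (2 * k) = 8 * K + (u + 1)" "u < 7" "even u"
    unfolding K_def u_def by presburger+
  have pow: "(2::nat) ^ (3 * i) = 8 ^ i" "(2::nat) ^ (3 * i + 1 + 0) = 8 ^ i + 8 ^ i"
    by (simp_all add: power_add power_mult)
  define s where "s = 8 ^ i * (8 * K + u)"
  have s: "8 ^ i * (2 * k) = s" "s + 8 ^ i = 8 ^ i * (8 * K + u + 1)"
      "s + 8 ^ i + 8 ^ i = 8 ^ i * (8 * K + (u + 1) + 1)"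
    by (simp_all only: s_def k(1) distrib_left mult_1_right add.assoc)
  have x: "x ! a = block_bit odd i B a" if "a \<in> {s..<s + (8 ^ i + 8 ^ i)}" for a
    using 0 that unfolding s(1) pow by blast
  have "x ! a \<longleftrightarrow> K \<in> B" if "a \<in> {s..<s + 8 ^ i}" for a
    using x[of a] that block_bit_unit[of a i K u odd B] k(3,4) unfolding s(2)
    by (simp add: s_def)
  moreover have "x ! a \<longleftrightarrow> K \<notin> B" if "a \<in> {s + 8 ^ i..<s + 8 ^ i + 8 ^ i}" for a
  proof -
    have "a \<in> {8 ^ i * (8 * K + (u + 1))..<8 ^ i * (8 * K + (u + 1) + 1)}"
      using that s(2,3) by (simp add: add.assoc)
    then show ?thesis
      using x[of a] that block_bit_unit[of a i K "u + 1" odd B] k(3,4) by simp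
  qed
  ultimately show ?case
    using formula_value_S1_iff[of "3 * i" s x] formula_value_S0_iff[of "3 * i" s x]
      formula_value_S1_iff[of "3 * i" "s + 8 ^ i" x] formula_value_S0_iff[of "3 * i" "s + 8 ^ i" x]
    by (cases "K \<in> B") (simp_all add: s(1) pow)
next
  case (Suc d)
  have step: "8 ^ i * (2 * k) + 2 ^ (3 * i + 1 + d) = 8 ^ i * (2 * (k + 2 ^ d))"
    unfolding power_add power_mult by (simp add: algebra_simps)
  have "formula_value (full_formula (3 * i + 1 + d) (8 ^ i * (2 * k))) x = SP"
    using Suc.prems by (intro Suc.IH) auto
  moreover have "formula_value (full_formula (3 * i + 1 + d) (8 ^ i * (2 * (k + 2 ^ d)))) x = SP"
  proof (rule Suc.IH)
    have "{8 ^ i * (2 * (k + 2 ^ d))..<8 ^ i * (2 * (k + 2 ^ d)) + 2 ^ (3 * i + 1 + d)} \<subseteq>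
        {8 ^ i * (2 * k)..<8 ^ i * (2 * k) + 2 ^ (3 * i + 1 + Suc d)}"
      unfolding step[symmetric] by auto
    then show "\<forall>a\<in>{8 ^ i * (2 * (k + 2 ^ d))..<8 ^ i * (2 * (k + 2 ^ d)) + 2 ^ (3 * i + 1 + d)}.
        x ! a = block_bit odd i B a"
      using Suc.prems by blast
  qed
  ultimately show ?case
    using step by simp
qed

lemma satisfies_block_input_odd:
  assumes "3 * i < h"
  shows "satisfies h (block_input odd h i B)"
proof -
  obtain d where h: "h = 3 * i + 1 + d"
    using assms less_iff_Suc_add by auto
  have "formula_value (full_formula h (8 ^ i * (2 * 0))) (block_input odd h i B) = SP"
    unfolding h by (rule formula_value_odd[where B = B]) simp
  then show ?thesis
    by (simp add: satisfies_def sub_balancing_formula_def)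
qed

section \<open>Inputs far from satisfying\<close>

text \<open>One half of each block carries three units of ones and one unit of zeros, whereas a
  subtree whose value is not \<open>SF1\<close> is all ones or at most half ones.\<close>

lemma far_pattern_block_dist:
  assumes "formula_value (full_formula (3 * Suc i) (8 ^ Suc i * k)) y \<noteq> SF1"
  shows "8 ^ i \<le> card {a\<in>{8 ^ Suc i * k..<8 ^ Suc i * (k + 1)}.
           block_bit far_pattern i B a \<noteq> y ! a}" (is "_ \<le> card ?D")
proof -
  \<comment> \<open>\<open>v\<close> selects the half of the block that reads 1110, and
    \<open>s\<close> is the first leaf of that half.\<close>
  define v where "v = (if k \<in> B then 4 else 0 :: nat)"
  define s where "s = 8 ^ i * (8 * k + v)"
  have pow: "(2::nat) ^ (3 * i + 2) = 4 * 8 ^ i"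
    by (simp add: power_add power_mult)
  have val: "formula_value (full_formula (3 * i + 2) s) y \<noteq> SF1"
  proof -
    have "full_formula (3 * Suc i) (8 ^ Suc i * k) =
        Gate (full_formula (3 * i + 2) (8 ^ Suc i * k))
          (full_formula (3 * i + 2) (8 ^ Suc i * k + 2 ^ (3 * i + 2)))"
      by (simp add: eval_nat_numeral)
    moreover have "s = 8 ^ Suc i * k \<or> s = 8 ^ Suc i * k + 2 ^ (3 * i + 2)"
      unfolding pow by (simp add: s_def v_def distrib_left)
    ultimately show ?thesis
      using assms by (auto simp only: formula_value.simps balancing_gate_eq_SF1)
  qed
  have sub: "{s..<s + 4 * 8 ^ i} \<subseteq> {8 ^ Suc i * k..<8 ^ Suc i * (k + 1)}"
    by (simp add: s_def v_def distrib_left)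
  have unit: "block_bit far_pattern i B a \<longleftrightarrow> w \<noteq> 3"
    if "a \<in> {s + w * 8 ^ i..<s + (w + 1) * 8 ^ i}" "w < 4" for a w
  proof -
    have "s + w * 8 ^ i = 8 ^ i * (8 * k + (v + w))"
        "s + (w + 1) * 8 ^ i = 8 ^ i * (8 * k + (v + w) + 1)"
      by (simp_all add: s_def distrib_left distrib_right mult.commute)
    moreover have "v + w < 8"
      using that(2) by (simp add: v_def)
    ultimately have "block_bit far_pattern i B a \<longleftrightarrow> (k \<in> B) \<noteq> far_pattern (v + w)"
      using that(1) block_bit_unit[of a i k "v + w" far_pattern B] by simp
    then show ?thesis
      using that(2) by (auto simp: far_pattern_def v_def)
  qed
  have one: "block_bit far_pattern i B a" if a: "a \<in> {s..<s + 3 * 8 ^ i}" for a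
  proof -
    consider "a < s + 8 ^ i" | "s + 8 ^ i \<le> a" "a < s + 2 * 8 ^ i" | "s + 2 * 8 ^ i \<le> a"
      by linarith
    then show ?thesis
      using a unit[of a 0] unit[of a 1] unit[of a 2] by cases simp_all
  qed
  have zero: "\<not> block_bit far_pattern i B a" if "a \<in> {s + 3 * 8 ^ i..<s + 4 * 8 ^ i}" for a
    using that unit[of a 3] by simp
  show ?thesis
  proof (cases "formula_value (full_formula (3 * i + 2) s) y = S1")
    case True
    then have "\<forall>a\<in>{s..<s + 4 * 8 ^ i}. y ! a"
      by (simp only: formula_value_S1_iff pow)
    then have "{s + 3 * 8 ^ i..<s + 4 * 8 ^ i} \<subseteq> ?D"
      using zero sub by fastforce
    then have "card {s + 3 * 8 ^ i..<s + 4 * 8 ^ i} \<le> card ?D"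
      by (intro card_mono) auto
    then show ?thesis
      by simp
  next
    case False
    let ?O = "{a\<in>{s..<s + 4 * 8 ^ i}. y ! a}"
    have "card ?O \<le> 2 * 8 ^ i"
      using card_ones_le_half[of "3 * i + 2" s y] False val unfolding pow by simp
    \<comment> \<open>Three units of ones face at most two units' worth of ones in \<open>y\<close>,
      which leaves one unit of disagreement.\<close>
    moreover have "{s..<s + 3 * 8 ^ i} \<subseteq> ?D \<union> ?O"
      using one sub by fastforce
    then have "card {s..<s + 3 * 8 ^ i} \<le> card (?D \<union> ?O)"
      by (intro card_mono) auto
    then have "card {s..<s + 3 * 8 ^ i} \<le> card ?D + card ?O"
      using card_Un_le le_trans by blast
    ultimately show ?thesis
      by simp
  qed
qed

text \<open>\<open>SF1\<close> is absorbing, so a value other than \<open>SF1\<close> at the top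
  passes down to all \<open>2 ^ d\<close> subtrees of height \<open>m\<close>. Their leaf sets are
  disjoint, hence the distances add up.\<close>

lemma subformula_dist:
  assumes "\<And>k. formula_value (full_formula m (2 ^ m * k)) y \<noteq> SF1 \<Longrightarrow>
      c \<le> card {a\<in>{2 ^ m * k..<2 ^ m * (k + 1)}. x a \<noteq> y ! a}"
    and "formula_value (full_formula (m + d) (2 ^ m * k)) y \<noteq> SF1"
  shows "2 ^ d * c \<le> card {a\<in>{2 ^ m * k..<2 ^ m * (k + 2 ^ d)}. x a \<noteq> y ! a}"
  using assms(2)
proof (induction d arbitrary: k)
  case 0
  then show ?case
    using assms(1)[of k] by simp
next
  case (Suc d)
  let ?D = "\<lambda>k l. {a\<in>{2 ^ m * k..<2 ^ m * l}. x a \<noteq> y ! a}"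
  have shift: "2 ^ m * k + 2 ^ (m + d) = 2 ^ m * (k + 2 ^ d)"
    by (simp add: power_add algebra_simps)
  have "2 ^ d * c \<le> card (?D k (k + 2 ^ d))"
    using Suc.prems by (intro Suc.IH) (auto simp: balancing_gate_eq_SF1)
  moreover have "2 ^ d * c \<le> card (?D (k + 2 ^ d) (k + 2 ^ d + 2 ^ d))"
    using Suc.prems shift by (intro Suc.IH) (auto simp: balancing_gate_eq_SF1)
  moreover have "card (?D k (k + 2 ^ d)) + card (?D (k + 2 ^ d) (k + 2 ^ d + 2 ^ d))
      = card (?D k (k + 2 ^ d) \<union> ?D (k + 2 ^ d) (k + 2 ^ d + 2 ^ d))"
    by (intro card_Un_disjoint[symmetric]) auto
  moreover have "?D k (k + 2 ^ d) \<union> ?D (k + 2 ^ d) (k + 2 ^ d + 2 ^ d) = ?D k (k + 2 ^ Suc d)"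
  proof -
    have "2 ^ m * k \<le> 2 ^ m * (k + 2 ^ d)"
        "2 ^ m * (k + 2 ^ d) \<le> 2 ^ m * (k + 2 ^ d + 2 ^ d)"
      by (intro mult_le_mono2; simp)+
    then have "{2 ^ m * k..<2 ^ m * (k + 2 ^ d)} \<union> {2 ^ m * (k + 2 ^ d)..<2 ^ m * (k + 2 ^ d + 2 ^ d)}
        = {2 ^ m * k..<2 ^ m * (k + 2 ^ d + 2 ^ d)}"
      by (rule ivl_disj_un_two)
    moreover have "k + 2 ^ d + 2 ^ d = k + 2 ^ Suc d"
      by simp
    moreover have "{a\<in>A. x a \<noteq> y ! a} \<union> {a\<in>A'. x a \<noteq> y ! a} =
        {a\<in>A \<union> A'. x a \<noteq> y ! a}" for A A'
      by blast
    ultimately show ?thesis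
      by (simp only:)
  qed
  ultimately show ?case
    by simp
qed

text \<open>Each block of \<open>8 ^ Suc i\<close> leaves contributes at least \<open>8 ^ i\<close>
  disagreements, a fraction of 1/8, which exceeds 1/12.\<close>

lemma is_far_block_input:
  assumes "3 * Suc i \<le> h"
  shows "is_far (1 / 12) h (block_input far_pattern h i B)"
  unfolding is_far_def
proof (intro ballI impI)
  fix y
  assume y: "y \<in> assignments h" "satisfies h y"
  let ?x = "block_input far_pattern h i B"
  obtain d where h: "h = 3 * Suc i + d"
    using assms le_Suc_ex by blast
  have pow: "(8::nat) ^ Suc i = 2 ^ (3 * Suc i)"
    by (simp only: power_mult) simp
  have pow_h: "2 ^ (3 * Suc i) * 2 ^ d = (2::nat) ^ h"
    by (simp only: h power_add)
  have block: "8 ^ i \<le> card {a\<in>{2 ^ (3 * Suc i) * k..<2 ^ (3 * Suc i) * (k + 1)}.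
         block_bit far_pattern i B a \<noteq> y ! a}"
    if "formula_value (full_formula (3 * Suc i) (2 ^ (3 * Suc i) * k)) y \<noteq> SF1" for k
    using far_pattern_block_dist[of i k y B] that unfolding pow by blast
  have "2 ^ d * 8 ^ i \<le> card {a\<in>{2 ^ (3 * Suc i) * 0..<2 ^ (3 * Suc i) * (0 + 2 ^ d)}.
          block_bit far_pattern i B a \<noteq> y ! a}"
    using y(2) by (intro subformula_dist block) (auto simp: satisfies_def sub_balancing_formula_def h)
  also have "{a\<in>{2 ^ (3 * Suc i) * 0..<2 ^ (3 * Suc i) * (0 + 2 ^ d)}.
      block_bit far_pattern i B a \<noteq> y ! a} = {a. a < length ?x \<and> ?x ! a \<noteq> y ! a}"
    by (auto simp: pow_h simp del: mult_Suc_right)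
  finally have "2 ^ d * 8 ^ i \<le> hamming_dist ?x y"
    by (simp add: hamming_dist_def)
  moreover have "(2::nat) ^ h = 8 * (2 ^ d * 8 ^ i)"
    by (simp add: h power_add power_mult)
  ultimately have "2 ^ h \<le> 8 * hamming_dist ?x y"
    by linarith
  then have "real (2 ^ h) \<le> real (8 * hamming_dist ?x y)"
    by (rule of_nat_mono)
  then have "2 ^ h \<le> 8 * real (hamming_dist ?x y)"
    by simp
  moreover have "(0::real) < 2 ^ h"
    by simp
  ultimately show "real (hamming_dist ?x y) > 1 / 12 * 2 ^ h"
    by linarith
qed

section \<open>Query sets and the levels they can distinguish\<close>

lemma accepts_cong:
  "\<forall>a\<in>set (queries t x). x ! a = y ! a \<Longrightarrow> accepts t x \<longleftrightarrow> accepts t y"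
  by (induction t) auto

text \<open>Levels where two positions of \<open>Q\<close> share a block but not a unit. Comparing
  their bits cancels the random complementation and can reveal the pattern.\<close>

definition separating_levels :: "nat \<Rightarrow> nat set \<Rightarrow> nat set" where
  "separating_levels m Q =
     {i. i < m \<and> (\<exists>a\<in>Q. \<exists>b\<in>Q. a div 8 ^ Suc i = b div 8 ^ Suc i \<and> a div 8 ^ i \<noteq> b div 8 ^ i)}"

text \<open>The number of units met by \<open>Q\<close> strictly decreases when a separating level is passed.\<close>

lemma card_separating_levels:
  assumes "finite Q"
  shows "card (separating_levels m Q) \<le> card Q"
proof -
  let ?f = "\<lambda>i. card ((\<lambda>a. a div 8 ^ i) ` Q)"
  \<comment> \<open>Strengthened for the induction by the number of units still met. At level 0
    units are single leaves, so equality holds.\<close>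
  have "card (separating_levels m Q) + ?f m \<le> card Q"
  proof (induction m)
    case 0
    then show ?case
      by (simp add: separating_levels_def)
  next
    case (Suc m)
    have image: "(\<lambda>a. a div 8 ^ Suc m) ` Q = (\<lambda>c. c div 8) ` (\<lambda>a. a div 8 ^ m) ` Q"
      by (simp add: image_image div_mult2_eq power_Suc2 del: power_Suc)
    then have le: "?f (Suc m) \<le> ?f m"
      using assms by (metis card_image_le finite_imageI)
    show ?case
    proof (cases "m \<in> separating_levels (Suc m) Q")
      case True
      then obtain a b where ab: "a \<in> Q" "b \<in> Q" "a div 8 ^ Suc m = b div 8 ^ Suc m"
          "a div 8 ^ m \<noteq> b div 8 ^ m"
        by (auto simp: separating_levels_def)
      then have "\<not> inj_on (\<lambda>c. c div 8) ((\<lambda>a. a div 8 ^ m) ` Q)"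
        unfolding inj_on_def power_Suc2 div_mult2_eq by blast
      then have "?f (Suc m) \<noteq> ?f m"
        using assms inj_on_iff_eq_card[of "(\<lambda>a. a div 8 ^ m) ` Q" "\<lambda>c. c div 8"] image by simp
      moreover have "separating_levels (Suc m) Q = insert m (separating_levels m Q)"
        using True by (auto simp: separating_levels_def less_Suc_eq)
      then have "card (separating_levels (Suc m) Q) \<le> Suc (card (separating_levels m Q))"
        by (simp add: card_insert_if separating_levels_def)
      ultimately show ?thesis
        using Suc le by linarith
    next
      case False
      then have "separating_levels (Suc m) Q = separating_levels m Q"
        by (auto simp: separating_levels_def less_Suc_eq)
      then show ?thesis
        using Suc le by simp
    qed
  qed
  then show ?thesis
    by simp
qed

text \<open>Off the separating levels every block is seen through a single unit, so complementing the
  blocks where the two patterns disagree on that unit turns one family into the other.\<close>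

lemma card_accepts_block_input_eq:
  assumes "i < m" "i \<notin> separating_levels m Q"
    and Q: "\<And>x. x \<in> assignments h \<Longrightarrow> set (queries t x) \<subseteq> Q" "Q \<subseteq> {..<2 ^ h}"
  shows "card {B\<in>Pow {..<2 ^ h}. accepts t (block_input p h i B)} =
         card {B\<in>Pow {..<2 ^ h}. accepts t (block_input p' h i B)}"
proof -
  define C where
    "C = {a div 8 ^ Suc i |a. a \<in> Q \<and> p (a div 8 ^ i mod 8) \<noteq> p' (a div 8 ^ i mod 8)}"
  have C: "C \<subseteq> {..<2 ^ h}"
    using Q(2) by (auto simp: C_def intro: le_less_trans[OF div_le_dividend])
  \<comment> \<open>At a level that is not separating, all positions of \<open>Q\<close> in one
    block share a unit, so any one of them decides whether the block is in \<open>C\<close>.\<close>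
  have C_iff: "a div 8 ^ Suc i \<in> C \<longleftrightarrow> p (a div 8 ^ i mod 8) \<noteq> p' (a div 8 ^ i mod 8)"
    if "a \<in> Q" for a
    using that assms(1,2) unfolding C_def separating_levels_def by (smt (verit) mem_Collect_eq)
  have eq: "accepts t (block_input p h i B) \<longleftrightarrow>
      accepts t (block_input p' h i (sym_diff B C))" for B
  proof (rule accepts_cong, intro ballI)
    fix a
    assume "a \<in> set (queries t (block_input p h i B))"
    then have "a \<in> Q"
      using Q(1)[of "block_input p h i B"] by (auto simp: assignments_def)
    then show "block_input p h i B ! a = block_input p' h i (sym_diff B C) ! a"
      using Q(2) C_iff[of a] by (auto simp: block_bit_def simp del: power_Suc)
  qed
  have invol: "sym_diff (sym_diff B C) C = B" for B
    by auto
  have "bij_betw (\<lambda>B. sym_diff B C) {B\<in>Pow {..<2 ^ h}. accepts t (block_input p h i B)}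
      {B\<in>Pow {..<2 ^ h}. accepts t (block_input p' h i B)}"
    using C eq by (intro bij_betw_byWitness[where f' = "\<lambda>B. sym_diff B C"]) (auto simp: invol)
  then show ?thesis
    by (rule bij_betw_same_card)
qed

section \<open>Averaging over levels and complementations\<close>

text \<open>The total acceptance gap over all levels and all \<open>B\<close> is at least 1/3 per
  term for a test, while a single tree gains only on separating levels, at most \<open>K\<close> of
  them. Here \<open>K\<close> bounds the positions a tree may read over all inputs.\<close>

lemma is_test_levels_le:
  assumes test: "is_test (1 / 12) h q T"
    and Q: "\<And>t. t \<in> set_pmf T \<Longrightarrow>
      \<exists>Q. finite Q \<and> card Q \<le> K \<and> (\<forall>x\<in>assignments h. set (queries t x) \<subseteq> Q)"
  shows "h div 3 \<le> 3 * K"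
proof -
  define m where "m = h div 3"
  \<comment> \<open>One index set serves all levels: each choice of complemented blocks at a level
    arises from equally many \<open>B\<close>, so a uniform \<open>B\<close> complements blocks
    independently.\<close>
  define P where "P = Pow {..<(2::nat) ^ h}"
  have P: "finite P" "card P > 0"
    by (auto simp: P_def card_Pow)
  let ?Y = "\<lambda>i B. {t. accepts t (block_input odd h i B)}"
  let ?N = "\<lambda>i B. {t. accepts t (block_input far_pattern h i B)}"
  define F :: "decision_tree \<Rightarrow> real" where
    "F t = (\<Sum>i<m. \<Sum>B\<in>P. indicator (?Y i B) t - indicator (?N i B) t)" for t
  have adv: "1 / 3 \<le> measure_pmf.prob T (?Y i B) - measure_pmf.prob T (?N i B)" if "i < m" for i B
  proof -
    have i: "3 * Suc i \<le> h"
      using that unfolding m_def by presburger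
    have "measure_pmf.prob T (?Y i B) \<ge> 2 / 3"
      using test satisfies_block_input_odd[of i h B] i
      by (simp add: is_test_def assignments_def)
    moreover have "measure_pmf.prob T {t. \<not> accepts t (block_input far_pattern h i B)} \<ge> 2 / 3"
      using test is_far_block_input[OF i, of B] by (simp add: is_test_def assignments_def)
    moreover have "{t. \<not> accepts t (block_input far_pattern h i B)} = UNIV - ?N i B"
      by auto
    ultimately show ?thesis
      using measure_pmf.prob_compl[of "?N i B" T] by simp
  qed
  have int: "integrable (measure_pmf T) (indicator A :: _ \<Rightarrow> real)" for A
    by (rule integrable_real_indicator)
      (simp_all add: measure_pmf.emeasure_finite less_top[symmetric])
  have "real m * (real (card P) / 3) = (\<Sum>i<m. \<Sum>B\<in>P. 1 / 3)"
    by simp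
  also have "\<dots> \<le> (\<Sum>i<m. \<Sum>B\<in>P. measure_pmf.prob T (?Y i B) - measure_pmf.prob T (?N i B))"
    by (intro sum_mono adv) auto
  also have "\<dots> = measure_pmf.expectation T F"
    unfolding F_def by (simp add: int)
  also have "\<dots> \<le> measure_pmf.expectation T (\<lambda>_. real K * real (card P))"
  proof (rule integral_mono_AE)
    show "integrable (measure_pmf T) F"
      unfolding F_def
      by (intro Bochner_Integration.integrable_sum Bochner_Integration.integrable_diff)
        (rule int)+
    show "AE t in measure_pmf T. F t \<le> real K * real (card P)"
      unfolding AE_measure_pmf_iff
    proof
      fix t
      assume t: "t \<in> set_pmf T"
      obtain Q0 where Q0: "finite Q0" "card Q0 \<le> K" "\<forall>x\<in>assignments h. set (queries t x) \<subseteq> Q0"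
        using Q[OF t] by blast
      \<comment> \<open>No query is lost, since a test reads only valid positions; the
        complementation argument needs the set in range.\<close>
      define Q' where "Q' = Q0 \<inter> {..<2 ^ h}"
      have Q': "finite Q'" "card Q' \<le> K" "Q' \<subseteq> {..<2 ^ h}"
        using Q0(1,2) card_mono[of Q0 Q'] by (auto simp: Q'_def)
      have queries: "set (queries t x) \<subseteq> Q'" if "x \<in> assignments h" for x
        using test t that Q0(3) by (auto simp: is_test_def Q'_def)
      let ?S = "separating_levels m Q'"
      have count: "(\<Sum>B\<in>P. indicator (?Y i B) t - indicator (?N i B) t) =
          real (card {B\<in>P. accepts t (block_input odd h i B)}) -
          real (card {B\<in>P. accepts t (block_input far_pattern h i B)})" for i
        using P(1) by (simp add: sum_subtractf indicator_def sum.If_cases Int_def)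
      have "(\<Sum>B\<in>P. indicator (?Y i B) t - indicator (?N i B) t) \<le>
          indicator ?S i * real (card P)" if "i < m" for i
      proof (cases "i \<in> ?S")
        case True
        have "card {B\<in>P. accepts t (block_input odd h i B)} \<le> card P"
          using P(1) by (intro card_mono) auto
        then show ?thesis
          using True by (simp add: count)
      next
        case False
        then have "card {B\<in>P. accepts t (block_input odd h i B)} =
            card {B\<in>P. accepts t (block_input far_pattern h i B)}"
          unfolding P_def by (intro card_accepts_block_input_eq[OF that _ queries Q'(3)])
        then show ?thesis
          by (simp add: count)
      qed
      then have "F t \<le> (\<Sum>i<m. indicator ?S i * real (card P))"
        unfolding F_def by (intro sum_mono) auto
      also have "\<dots> = real (card ?S) * real (card P)"
      proof -
        have "{..<m} \<inter> ?S = ?S"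
          by (auto simp: separating_levels_def)
        then show ?thesis
          by (simp add: sum_distrib_right[symmetric] indicator_def)
      qed
      also have "\<dots> \<le> real K * real (card P)"
        using card_separating_levels[OF Q'(1), of m] Q'(2) by (intro mult_right_mono) auto
      finally show "F t \<le> real K * real (card P)" .
    qed
  qed auto
  also have "\<dots> = real K * real (card P)"
    by simp
  finally have "real m \<le> 3 * real K"
    using P(2) by (simp add: field_simps)
  then show ?thesis
    unfolding m_def by linarith
qed

section \<open>Positions readable by an adaptive tree, and the final bounds\<close>

text \<open>Splitting \<open>X\<close> by the bit read gives 1 + (\<open>2 ^ r\<close> - 1) +
  (\<open>2 ^ r\<close> - 1) < \<open>2 ^ Suc r\<close>, so the strict bound closes the induction.
  Restricting to \<open>X\<close> ignores branches that no input reaches.\<close>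

lemma card_all_queries:
  assumes "\<forall>x\<in>X. length (queries t x) \<le> q"
  shows "finite (\<Union>x\<in>X. set (queries t x)) \<and> card (\<Union>x\<in>X. set (queries t x)) < 2 ^ q"
  using assms
proof (induction t arbitrary: X q)
  case (Answer b)
  then show ?case
    by simp
next
  case (Query i t u)
  show ?case
  \<comment> \<open>For empty \<open>X\<close> the length bound is vacuous and \<open>q\<close> may
    be 0.\<close>
  proof (cases "X = {}")
    case False
    then obtain r where q: "q = Suc r"
      using Query.prems by (cases q) auto
    let ?T = "\<Union>x\<in>{x\<in>X. x ! i}. set (queries t x)"
    let ?U = "\<Union>x\<in>{x\<in>X. \<not> x ! i}. set (queries u x)"
    have sub: "(\<Union>x\<in>X. set (queries (Query i t u) x)) \<subseteq> insert i (?T \<union> ?U)"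
      by (auto split: if_splits)
    have "\<forall>x\<in>{x\<in>X. x ! i}. length (queries t x) \<le> r"
        "\<forall>x\<in>{x\<in>X. \<not> x ! i}. length (queries u x) \<le> r"
      using Query.prems q by auto
    then have TU: "finite ?T" "card ?T < 2 ^ r" "finite ?U" "card ?U < 2 ^ r"
      using Query.IH by blast+
    have "card (insert i (?T \<union> ?U)) \<le> Suc (card ?T + card ?U)"
      using card_Un_le[of ?T ?U] TU by (auto simp: card_insert_if)
    then show ?thesis
      using sub TU card_mono[OF _ sub] finite_subset[OF sub] by (auto simp: q)
  qed auto
qed

theorem theorem7p14:
  "(\<exists>c::real. c > 0 \<and>
      (\<forall>\<^sub>F h in sequentially. \<forall>q T. is_test (1 / 12) h q T \<and> nonadaptive h T \<longrightarrow>
         real q \<ge> c * real h)) \<and>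
   (\<exists>c::real. c > 0 \<and>
      (\<forall>\<^sub>F h in sequentially. \<forall>q T. is_test (1 / 12) h q T \<longrightarrow>
         real q \<ge> c * log 2 (real h)))"
proof (intro conjI exI)
  show "\<forall>\<^sub>F h in sequentially. \<forall>q T. is_test (1 / 12) h q T \<and> nonadaptive h T \<longrightarrow>
      real q \<ge> 1 / 18 * real h"
    \<comment> \<open>From 4 on, \<open>h div 3\<close> is at least \<open>h / 6\<close>, and
      \<open>h / 6 \<le> 3 * q\<close> yields the constant 1/18.\<close>
    using eventually_ge_at_top[of 4]
  proof (eventually_elim, intro allI impI)
    fix h q :: nat and T
    assume h: "4 \<le> h" and T: "is_test (1 / 12) h q T \<and> nonadaptive h T"
    define x0 where "x0 = replicate (2 ^ h) False"
    have x0: "x0 \<in> assignments h"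
      by (simp add: x0_def assignments_def)
    have "h div 3 \<le> 3 * q"
    proof (rule is_test_levels_le[OF conjunct1[OF T]], intro exI conjI ballI)
      fix t
      assume t: "t \<in> set_pmf T"
      show "card (set (queries t x0)) \<le> q"
        using T t x0 card_length[of "queries t x0"] by (force simp: is_test_def)
      show "set (queries t x) \<subseteq> set (queries t x0)" if "x \<in> assignments h" for x
      proof -
        have "queries t x = queries t x0"
          using T t x0 that unfolding nonadaptive_def by blast
        then show ?thesis
          by (simp only: order_refl)
      qed
    qed auto
    then show "real q \<ge> 1 / 18 * real h"
      using h by linarith
  qed
  show "\<forall>\<^sub>F h in sequentially. \<forall>q T. is_test (1 / 12) h q T \<longrightarrow>
      real q \<ge> 1 / 2 * log 2 (real h)"
    \<comment> \<open>With \<open>18 * 18 \<le> h\<close>, squaring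
      \<open>h \<le> 18 * 2 ^ q\<close> gives \<open>h * h \<le> h * 2 ^ (2 * q)\<close>; the factor
      18 is absorbed at the price of the constant 1/2.\<close>
    using eventually_ge_at_top[of "18 * 18"]
  proof (eventually_elim, intro allI impI)
    fix h q :: nat and T
    assume h: "18 * 18 \<le> h" and T: "is_test (1 / 12) h q T"
    have "h div 3 \<le> 3 * 2 ^ q"
    proof (rule is_test_levels_le[OF T], intro exI conjI ballI)
      fix t
      assume t: "t \<in> set_pmf T"
      let ?Q = "\<Union>x\<in>assignments h. set (queries t x)"
      have *: "finite ?Q \<and> card ?Q < 2 ^ q"
        using T t by (intro card_all_queries) (auto simp: is_test_def)
      show "finite ?Q" "card ?Q \<le> 2 ^ q"
        using * by auto
    qed auto
    then have "h \<le> 18 * 2 ^ q"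
      using h by linarith
    then have "h * h \<le> (18 * 2 ^ q) * (18 * 2 ^ q)"
      by (intro mult_le_mono)
    also have "\<dots> = 18 * 18 * (2 ^ q * 2 ^ q)"
      by simp
    also have "\<dots> \<le> h * (2 ^ q * 2 ^ q)"
      using h by (intro mult_le_mono) auto
    finally have "h \<le> 2 ^ (2 * q)"
      using h by (simp add: mult_2 power_add)
    then have "real h \<le> 2 powr (2 * real q)"
      by (metis of_nat_mono of_nat_power of_nat_numeral powr_realpow zero_less_numeral
          of_nat_mult)
    then have "log 2 (real h) \<le> 2 * real q"
      using h by (simp add: log_le_iff)
    then show "real q \<ge> 1 / 2 * log 2 (real h)"
      by simp
  qed
qed auto

end
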